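(* Let $T$ be a tree with $\kappa_{\mathrm m}(T)=2$, and suppose that $H=R\cup U$ (disjoint union) is a disconnected graph generalized cospectral with $T$, where $R$ is a tree and $U$ is a connected bipartite unicyclic graph. Let $C=C_{2\ell}$, $\ell\ge2$, be the unique cycle of $U$, and put $F:=U-V(C)$, which is a forest. Then $$\phi_U(x)=\mu_U(x)-2\mu_F(x).$$ For every $k\ge0$, $$m_k(T)=m_k(H)-2(-1)^\ell\, m_{k-\ell}(R\cup F),$$ with the convention $m_j(X)=0$ for $j<0$. Hence $m_k(T)=m_k(H)$ for $k<\ell$, while $m_\ell(T)-m_\ell(H)=-2(-1)^\ell$.
   Context: All graphs are finite, simple and undirected. For a graph $X$, $A(X)$ is its adjacency matrix and $\phi_X(x)=\det(xI-A(X))$; $m_k(X)$ is the number of $k$-matchings of $X$ (sets of $k$ pairwise disjoint edges), with $m_0(X)=1$, and $\mu_X(x):=\sum_{k\ge0}(-1)^k m_k(X)x^{|V(X)|-2k}$ is the matching polynomial (equal to $1$ for the graph with no vertices). Two graphs are generalized cospectral if they have the same adjacency spectrum and their complements have the same adjacency spectrum. An adjacency eigenvalue is main if its eigenspace is not orthogonal to the all-one vector; the main polynomial $M_X(x)$ is the product of $(x-\lambda)$ over the distinct main eigenvalues $\lambda$ of $X$ (it divides $\phi_X$ in $\mathbb Z[x]$). If $\phi_X=\prod_{i=1}^r f_i^{m_i}$ with $f_i$ distinct, monic and irreducible over $\mathbb Q$, the main-factor multiplicity is $\kappa_{\mathrm m}(X):=\sum_{i:\,f_i\mid M_X} m_i$.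 A connected graph is unicyclic if it contains exactly one cycle. $U-V(C)$ is the graph obtained from $U$ by deleting all vertices of $C$. *)

theory Defs
  imports
    Complex_Main
    "HOL-Computational_Algebra.Computational_Algebra"
    "HOL-Computational_Algebra.Field_as_Ring"
    "Jordan_Normal_Form.Char_Poly"
begin

section \<open>Finite simple undirected graphs\<close>

text \<open>An edge is a two-element set of vertices.\<close>

datatype 'a graph = Graph (verts: "'a set") (edges: "'a set set")

definition simple_graph :: "'a graph \<Rightarrow> bool" where
  "simple_graph X \<longleftrightarrow>
     finite (verts X) \<and> (\<forall>e\<in>edges X. e \<subseteq> verts X \<and> card e = 2)"

definition complement :: "'a graph \<Rightarrow> 'a graph" where
  "complement X = Graph (verts X) ({e. e \<subseteq> verts X \<and> card e = 2} - edges X)"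

text \<open>This is the disjoint union of two graphs whose vertex sets are disjoint.\<close>

definition graph_union :: "'a graph \<Rightarrow> 'a graph \<Rightarrow> 'a graph" where
  "graph_union X Y = Graph (verts X \<union> verts Y) (edges X \<union> edges Y)"

definition delete_verts :: "'a graph \<Rightarrow> 'a set \<Rightarrow> 'a graph" where
  "delete_verts X S = Graph (verts X - S) {e \<in> edges X. e \<inter> S = {}}"

definition graph_connected :: "'a graph \<Rightarrow> bool" where
  "graph_connected X \<longleftrightarrow> verts X \<noteq> {} \<and>
     (\<forall>u\<in>verts X. \<forall>v\<in>verts X. (u, v) \<in> {(a, b). {a, b} \<in> edges X}\<^sup>*)"

text \<open>Cycles are subgraphs, so that rotating or reversing a cyclic list of vertices does not
  give a new cycle.\<close>

definition cycle_graph :: "'a list \<Rightarrow> 'a graph" where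
  "cycle_graph vs =
     Graph (set vs) {{vs ! i, vs ! (Suc i mod length vs)} | i. i < length vs}"

definition cycle_of :: "'a graph \<Rightarrow> 'a graph \<Rightarrow> bool" where
  "cycle_of C X \<longleftrightarrow>
     (\<exists>vs. distinct vs \<and> 3 \<le> length vs \<and> C = cycle_graph vs) \<and>
     verts C \<subseteq> verts X \<and> edges C \<subseteq> edges X"

definition forest :: "'a graph \<Rightarrow> bool" where
  "forest X \<longleftrightarrow> (\<nexists>C. cycle_of C X)"

definition tree :: "'a graph \<Rightarrow> bool" where
  "tree X \<longleftrightarrow> graph_connected X \<and> forest X"

definition unicyclic :: "'a graph \<Rightarrow> bool" where
  "unicyclic X \<longleftrightarrow> graph_connected X \<and> (\<exists>!C. cycle_of C X)"

definition bipartite :: "'a graph \<Rightarrow> bool" where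
  "bipartite X \<longleftrightarrow> (\<exists>S. S \<subseteq> verts X \<and>
     (\<forall>e\<in>edges X. \<exists>u v. e = {u, v} \<and> u \<in> S \<and> v \<in> verts X - S))"


section \<open>Matchings\<close>

definition matching :: "'a graph \<Rightarrow> 'a set set \<Rightarrow> bool" where
  "matching X M \<longleftrightarrow> M \<subseteq> edges X \<and> (\<forall>e\<in>M. \<forall>f\<in>M. e \<noteq> f \<longrightarrow> e \<inter> f = {})"

definition num_matchings :: "'a graph \<Rightarrow> nat \<Rightarrow> nat" where
  "num_matchings X k = card {M. matching X M \<and> finite M \<and> card M = k}"

text \<open>A \<open>k\<close>-matching covers \<open>2 * k\<close> vertices, so the sum over all \<open>k\<close> ends
  at \<open>card (verts X) div 2\<close>; in this range the subtraction in the exponent does not truncate.\<close>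

definition matching_poly :: "'a graph \<Rightarrow> int poly" where
  "matching_poly X = (\<Sum>k\<le>card (verts X) div 2.
     monom ((-1) ^ k * int (num_matchings X k)) (card (verts X) - 2 * k))"


section \<open>Adjacency matrix and spectrum\<close>

definition adj_matrix_wrt :: "'a list \<Rightarrow> 'a graph \<Rightarrow> 'b::comm_ring_1 mat" where
  "adj_matrix_wrt vs X = mat (length vs) (length vs)
     (\<lambda>(i, j). if {vs ! i, vs ! j} \<in> edges X then 1 else 0)"

definition vertex_list :: "'a graph \<Rightarrow> 'a list" where
  "vertex_list X = (SOME vs. distinct vs \<and> set vs = verts X)"

text \<open>The rows and columns are indexed by an arbitrary but fixed enumeration of the vertices;
  see \<open>char_poly_adj_matrix_wrt\<close> below for the independence of the characteristic
  polynomial from this choice.\<close>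

definition adj_matrix :: "'a graph \<Rightarrow> 'b::comm_ring_1 mat" where
  "adj_matrix X = adj_matrix_wrt (vertex_list X) X"

definition graph_char_poly :: "'a graph \<Rightarrow> int poly" where
  "graph_char_poly X = char_poly (adj_matrix X)"

text \<open>Eigenvalues are taken in the complex numbers, where the characteristic polynomial splits;
  as the matrix is real symmetric, they are all real.\<close>

definition adj_spectrum :: "'a graph \<Rightarrow> complex multiset" where
  "adj_spectrum X = proots (char_poly (adj_matrix X))"

definition generalized_cospectral :: "'a graph \<Rightarrow> 'b graph \<Rightarrow> bool" where
  "generalized_cospectral X Y \<longleftrightarrow>
     adj_spectrum X = adj_spectrum Y \<and>
     adj_spectrum (complement X) = adj_spectrum (complement Y)"

definition main_eigenvalue :: "'a graph \<Rightarrow> complex \<Rightarrow> bool" where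
  "main_eigenvalue X k \<longleftrightarrow>
     (\<exists>v. eigenvector (adj_matrix X) v k \<and> v \<bullet> vec (card (verts X)) (\<lambda>_. 1) \<noteq> 0)"

definition main_poly :: "'a graph \<Rightarrow> complex poly" where
  "main_poly X = (\<Prod>k | main_eigenvalue X k. [:- k, 1:])"

definition main_factor_multiplicity :: "'a graph \<Rightarrow> nat" where
  "main_factor_multiplicity X =
     (let \<phi> = map_poly of_int (graph_char_poly X) :: rat poly in
      \<Sum>f | lead_coeff f = 1 \<and> irreducible f \<and> f dvd \<phi> \<and>
           map_poly of_rat f dvd main_poly X. multiplicity f \<phi>)"


section \<open>Independence of the vertex enumeration\<close>

lemma vertex_list:
  assumes "finite (verts X)"
  shows "distinct (vertex_list X)" "set (vertex_list X) = verts X"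
proof -
  have "\<exists>vs. distinct vs \<and> set vs = verts X"
    using finite_distinct_list[OF assms] by blast
  from someI_ex[OF this] show "distinct (vertex_list X)" "set (vertex_list X) = verts X"
    unfolding vertex_list_def by auto
qed

lemma det_permute_both:
  fixes A :: "'b::comm_ring_1 mat"
  assumes A: "A \<in> carrier_mat n n" and p: "p permutes {0..<n}"
  shows "det (mat n n (\<lambda>(i, j). A $$ (p i, p j))) = det A"
proof -
  have pi: "p i < n" if "i < n" for i
    using permutes_in_image[OF p, of i] that by simp
  define B where "B = mat n n (\<lambda>(i, j). A $$ (p i, j))"
  have B: "B \<in> carrier_mat n n" by (simp add: B_def)
  have "det (mat n n (\<lambda>(i, j). A $$ (p i, p j))) =
      det (transpose_mat (mat n n (\<lambda>(i, j). A $$ (p i, p j))))"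
    by (rule det_transpose[of _ n, symmetric]) simp
  also have "transpose_mat (mat n n (\<lambda>(i, j). A $$ (p i, p j))) =
      mat n n (\<lambda>(i, j). transpose_mat B $$ (p i, j))"
    using pi by (intro eq_matI) (auto simp: B_def)
  also have "det \<dots> = signof p * det (transpose_mat B)"
    by (rule det_permute_rows) (use B p in auto)
  also have "det (transpose_mat B) = det B" by (rule det_transpose[OF B])
  also have "det B = signof p * det A"
    unfolding B_def by (rule det_permute_rows[OF A p])
  finally show ?thesis by (simp add: sign_def)
qed

lemma char_poly_adj_matrix_wrt:
  assumes "distinct vs" "set vs = verts X"
  shows "char_poly (adj_matrix_wrt vs X :: 'b::comm_ring_1 mat) = char_poly (adj_matrix X)"
proof -
  define ws where "ws = vertex_list X"
  have fin: "finite (verts X)" using assms(2) by (metis List.finite_set)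
  have ws: "distinct ws" "set ws = verts X"
    using vertex_list[OF fin] by (auto simp: ws_def)
  define n where "n = length vs"
  have n': "length ws = n" using assms ws by (metis distinct_card n_def)
  have "mset vs = mset ws" using assms ws 
    by (metis set_eq_iff_mset_eq_distinct)
  then obtain p where p: "p permutes {..<n}" "permute_list p ws = vs"
    by (metis mset_eq_permutation n')
  have p0: "p permutes {0..<n}" using p(1) by (simp add: atLeast0LessThan)
  have pi: "p i < n" if "i < n" for i
    using permutes_in_image[OF p0, of i] that by simp
  have nth: "vs ! i = ws ! p i" if "i < n" for i
    using p that n' by (metis permute_list_nth)
  have inj: "p i = p j \<longleftrightarrow> i = j" for i j using permutes_inj[OF p0] by (auto simp: inj_def)
  let ?A = "adj_matrix_wrt vs X :: 'b mat" and ?B = "adj_matrix X :: 'b mat"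
  have B: "?B \<in> carrier_mat n n" by (simp add: adj_matrix_def adj_matrix_wrt_def ws_def[symmetric] n')
  have "char_poly_matrix ?A = mat n n (\<lambda>(i, j). char_poly_matrix ?B $$ (p i, p j))"
    by (rule eq_matI)
      (auto simp: char_poly_matrix_def adj_matrix_def adj_matrix_wrt_def ws_def[symmetric]
         n_def[symmetric] n' nth pi inj)
  then show ?thesis
    unfolding char_poly_def using det_permute_both[OF _ p0, of "char_poly_matrix ?B"] B by simp
qed

end

theory Submission
  imports Defs "HOL-Combinatorics.Cycles"
begin

text \<open>In the Leibniz expansion of \<open>det (x I - A(X))\<close> only the permutations that move vertices along
  edges survive. The involutions among them are the matchings of \<open>X\<close>, and they sum to \<open>\<mu>\<^sub>X\<close>. A point
  \<open>v\<close> with \<open>p (p v) \<noteq> v\<close> has an orbit of length at least three, which is a cycle of \<open>X\<close>; so if \<open>C\<close> is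
  the only cycle of \<open>X\<close>, a non-involution is a rotation of \<open>C\<close> in one of its two directions times an
  involution of \<open>X - V(C)\<close>. Each rotation contributes the factor \<open>-1\<close>, whence
  \<open>\<phi>\<^sub>X = \<mu>\<^sub>X - 2 \<mu>\<^bsub>X - V(C)\<^esub>\<close>. Since \<open>R\<close> is a tree, \<open>C\<close> is also the only cycle of \<open>H\<close>, so this applies
  to \<open>H\<close> directly; comparing coefficients with \<open>\<phi>\<^sub>T = \<mu>\<^sub>T\<close> gives the matching numbers.\<close>

section \<open>Permutations along edges\<close>

text \<open>Fixed points are allowed: in the Leibniz expansion they pick a diagonal entry of xI - A,
  while a moved vertex must pick a nonzero off-diagonal one.\<close>

definition graph_perm :: "'a graph \<Rightarrow> ('a \<Rightarrow> 'a) \<Rightarrow> bool" where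
  "graph_perm X p \<longleftrightarrow> p permutes verts X \<and> (\<forall>v. p v \<noteq> v \<longrightarrow> {v, p v} \<in> edges X)"

text \<open>The Leibniz summand of det(xI - A) at a permutation along edges. The vertex set is a
  parameter so that the summand can be factored over a set and its complement.\<close>

definition perm_term :: "'a set \<Rightarrow> ('a \<Rightarrow> 'a) \<Rightarrow> int poly" where
  "perm_term V p = of_int (sign p) * (\<Prod>v\<in>V. if p v = v then [:0, 1:] else - 1)"

lemma finite_graph_perms:
  assumes "finite (verts X)"
  shows "finite {p. graph_perm X p}"
  by (rule finite_subset[OF _ finite_permutations[OF assms]]) (auto simp: graph_perm_def)

text \<open>Conjugation by the enumeration \<open>vs\<close> carries permutations of indices to
  permutations of vertices and preserves the sign, so the Leibniz formula can be read on the
  vertices themselves.\<close>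

lemma det_mat_nth:
  fixes M :: "'a \<Rightarrow> 'a \<Rightarrow> 'b::comm_ring_1"
  assumes "distinct vs"
  shows "det (mat (length vs) (length vs) (\<lambda>(i, j). M (vs ! i) (vs ! j))) =
    (\<Sum>p | p permutes set vs. of_int (sign p) * (\<Prod>v\<in>set vs. M v (p v)))"
proof -
  define n where "n = length vs"
  define f where "f = map_permutation {0..<n} (nth vs)"
  define g where "g = map_permutation (set vs) (inv_into {0..<n} (nth vs))"
  have bij: "bij_betw (nth vs) {0..<n} (set vs)"
    using assms by (intro bij_betw_nth) (auto simp: n_def)
  then have inj: "inj_on (nth vs) {0..<n}" by (rule bij_betw_imp_inj_on)
  have bij': "bij_betw (inv_into {0..<n} (nth vs)) (set vs) {0..<n}"
    using bij by (rule bij_betw_inv_into)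
  have "det (mat n n (\<lambda>(i, j). M (vs ! i) (vs ! j))) =
    (\<Sum>p | p permutes {0..<n}. of_int (sign p) * (\<Prod>i = 0..<n. M (vs ! i) (vs ! p i)))"
    by (subst det_def'[of _ n])
      (auto intro!: sum.cong prod.cong arg_cong2[where f = "(*)"] dest: permutes_in_image
        simp: sign_def split: if_splits)
  also have "\<dots> = (\<Sum>p | p permutes set vs. of_int (sign p) * (\<Prod>v\<in>set vs. M v (p v)))"
  proof (rule sum.reindex_bij_witness[of _ g f])
    fix p assume "p \<in> {p. p permutes {0..<n}}"
    then have p: "p permutes {0..<n}" by simp
    show "g (f p) = p" unfolding f_def g_def
      by (rule map_permutation_compose_inv[OF bij p])
        (auto simp: inv_into_f_f[OF inj])
    show "f p \<in> {p. p permutes set vs}"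
      unfolding f_def using map_permutation_permutes[OF bij p] by simp
    have sgn: "sign (f p) = sign p"
      unfolding f_def by (rule sign_map_permutation[OF inj p]) simp
    have "(\<Prod>v\<in>set vs. M v (f p v)) = (\<Prod>i = 0..<n. M (vs ! i) (f p (vs ! i)))"
      by (rule prod.reindex_bij_betw[OF bij, symmetric])
    also have "\<dots> = (\<Prod>i = 0..<n. M (vs ! i) (vs ! p i))"
      by (intro prod.cong refl) (simp add: f_def map_permutation_apply[OF inj])
    finally show "of_int (sign (f p)) * (\<Prod>v\<in>set vs. M v (f p v)) =
        of_int (sign p) * (\<Prod>i = 0..<n. M (vs ! i) (vs ! p i))"
      by (simp add: sgn)
  next
    fix p assume "p \<in> {p. p permutes set vs}"
    then have p: "p permutes set vs" by simp
    show "f (g p) = p" unfolding f_def g_def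
      by (rule map_permutation_compose_inv[OF bij' p])
        (use bij in \<open>auto simp: bij_betw_inv_into_right\<close>)
    show "g p \<in> {p. p permutes {0..<n}}"
      unfolding g_def using map_permutation_permutes[OF bij' p] by simp
  qed
  finally show ?thesis by (simp add: n_def)
qed

lemma graph_char_poly_eq_sum_perms:
  assumes "simple_graph X"
  shows "graph_char_poly X = (\<Sum>p | graph_perm X p. perm_term (verts X) p)"
proof -
  define M where "M = (\<lambda>u w. if u = w then [:0, 1:]
    else if {u, w} \<in> edges X then - 1 else (0 :: int poly))"
  have fin: "finite (verts X)" using assms by (simp add: simple_graph_def)
  \<comment> \<open>Absence of loops makes the diagonal of xI - A exactly x, in agreement with
    \<open>M\<close>.\<close>
  have loop: "{v} \<notin> edges X" for v using assms by (auto simp: simple_graph_def)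
  define vs where "vs = vertex_list X"
  have vs: "distinct vs" "set vs = verts X" using vertex_list[OF fin] by (auto simp: vs_def)
  have "char_poly_matrix (adj_matrix X) =
      mat (length vs) (length vs) (\<lambda>(i, j). M (vs ! i) (vs ! j))"
    by (rule eq_matI)
      (use vs loop in \<open>auto simp: char_poly_matrix_def adj_matrix_def adj_matrix_wrt_def M_def vs_def
        nth_eq_iff_index_eq one_pCons\<close>)
  then have "graph_char_poly X =
      (\<Sum>p | p permutes verts X. of_int (sign p) * (\<Prod>v\<in>verts X. M v (p v)))"
    unfolding graph_char_poly_def char_poly_def using det_mat_nth[OF vs(1), of M] vs(2) by simp
  also have "\<dots> = (\<Sum>p | graph_perm X p. of_int (sign p) * (\<Prod>v\<in>verts X. M v (p v)))"
  proof (rule sum.mono_neutral_right)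
    show "finite {p. p permutes verts X}" using fin by (rule finite_permutations)
    show "{p. graph_perm X p} \<subseteq> {p. p permutes verts X}" by (auto simp: graph_perm_def)
    show "\<forall>p\<in>{p. p permutes verts X} - {p. graph_perm X p}.
        of_int (sign p) * (\<Prod>v\<in>verts X. M v (p v)) = 0"
    proof
      fix p assume "p \<in> {p. p permutes verts X} - {p. graph_perm X p}"
      then obtain v where "p permutes verts X" "p v \<noteq> v" "{v, p v} \<notin> edges X"
        by (auto simp: graph_perm_def)
      then have "v \<in> verts X" "M v (p v) = 0" by (auto simp: M_def dest: permutes_not_in)
      then have "(\<Prod>v\<in>verts X. M v (p v)) = 0" using fin by (intro prod_zero) auto
      then show "of_int (sign p) * (\<Prod>v\<in>verts X. M v (p v)) = 0" by simp
    qed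
  qed
  also have "\<dots> = (\<Sum>p | graph_perm X p. perm_term (verts X) p)"
    unfolding perm_term_def
    by (intro sum.cong prod.cong arg_cong2[where f = "(*)"] refl) (auto simp: M_def graph_perm_def)
  finally show ?thesis .
qed

text \<open>The composition acts as \<open>c\<close> on \<open>S\<close> and as \<open>q\<close> off
  \<open>S\<close>, so the product splits; the sign is multiplicative.\<close>

lemma perm_term_compose:
  assumes "finite V" "S \<subseteq> V" "c permutes S" "q permutes V - S"
  shows "perm_term V (c \<circ> q) = perm_term S c * perm_term (V - S) q"
proof -
  have fin: "finite S" "finite (V - S)" using assms by (auto intro: finite_subset)
  have sgn: "sign (c \<circ> q) = sign c * sign q"
    using assms fin by (intro sign_compose) (auto intro: permutes_imp_permutation)
  have 1: "(c \<circ> q) v = c v" if "v \<in> S" for v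
    using that assms(4) by (auto dest: permutes_not_in)
  have 2: "(c \<circ> q) v = q v" if "v \<in> V - S" for v
    using that permutes_in_image[OF assms(4), of v] assms(3) by (auto dest: permutes_not_in)
  have "(\<Prod>v\<in>V. if (c \<circ> q) v = v then [:0, 1:] else - 1 :: int poly) =
      (\<Prod>v\<in>V - S. if (c \<circ> q) v = v then [:0, 1:] else - 1) *
      (\<Prod>v\<in>S. if (c \<circ> q) v = v then [:0, 1:] else - 1)"
    using assms by (intro prod.subset_diff) auto
  also have "(\<Prod>v\<in>S. if (c \<circ> q) v = v then [:0, 1:] else - 1 :: int poly) =
      (\<Prod>v\<in>S. if c v = v then [:0, 1:] else - 1)"
    by (intro prod.cong) (simp_all add: 1 del: o_apply)
  also have "(\<Prod>v\<in>V - S. if (c \<circ> q) v = v then [:0, 1:] else - 1 :: int poly) =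
      (\<Prod>v\<in>V - S. if q v = v then [:0, 1:] else - 1)"
    by (intro prod.cong) (simp_all add: 2 del: o_apply)
  finally show ?thesis by (simp add: perm_term_def sgn mult_ac)
qed


section \<open>Involutions and matchings\<close>

text \<open>For an involution these are its 2-cycles as unordered pairs, each arising from both of
  its points.\<close>

definition moved_pairs :: "('a \<Rightarrow> 'a) \<Rightarrow> 'a set set" where
  "moved_pairs p = {{v, p v} | v. p v \<noteq> v}"

text \<open>Induction on the size of the support: peeling off one 2-cycle removes two moved points
  and one pair and flips the sign.\<close>

lemma involution_moved_pairs:
  assumes "finite V" "p permutes V" "\<And>v. p (p v) = v"
  shows "finite (moved_pairs p) \<and> card {v. p v \<noteq> v} = 2 * card (moved_pairs p) \<and>
    sign p = (- 1) ^ card (moved_pairs p)"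
  using assms(2,3)
proof (induction "card {v. p v \<noteq> v}" arbitrary: p rule: less_induct)
  case less
  have fin: "finite {v. p v \<noteq> v}"
    using less.prems(1) assms(1) by (auto intro: finite_subset dest: permutes_not_in)
  show ?case
  proof (cases "\<exists>a. p a \<noteq> a")
    case False
    then have "p = id" by auto
    then show ?thesis by (simp add: moved_pairs_def)
  next
    case True
    then obtain a where a: "p a \<noteq> a" by blast
    \<comment> \<open>\<open>q\<close> agrees with \<open>p\<close> except that it fixes
      \<open>a\<close> and \<open>p a\<close>.\<close>
    define q where "q = transpose a (p a) \<circ> p"
    have inj: "p v = p w \<longleftrightarrow> v = w" for v w using less.prems(2) by metis
    have q: "q v = (if v = a \<or> v = p a then v else p v)" for v
      using less.prems(2) inj a by (auto simp: q_def transpose_def)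
    have aV: "a \<in> V" "p a \<in> V"
      using a less.prems(1) permutes_in_image[OF less.prems(1), of a] by (auto dest: permutes_not_in)
    have qV: "q permutes V"
      unfolding q_def using less.prems(1) aV by (intro permutes_compose permutes_swap_id)
    have qq: "q (q v) = v" for v using less.prems(2) inj by (auto simp: q)
    have supp: "{v. p v \<noteq> v} = insert a (insert (p a) {v. q v \<noteq> v})"
      using a less.prems(2) by (auto simp: q)
    have finq: "finite {v. q v \<noteq> v}" using fin by (rule finite_subset[rotated]) (auto simp: q)
    have card_supp: "card {v. p v \<noteq> v} = Suc (Suc (card {v. q v \<noteq> v}))"
      unfolding supp using a finq by (simp add: q)
    have IH: "finite (moved_pairs q)" "card {v. q v \<noteq> v} = 2 * card (moved_pairs q)"
        "sign q = (- 1) ^ card (moved_pairs q)"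
      using less.hyps[OF _ qV qq] card_supp by auto
    have "moved_pairs p = insert {a, p a} (moved_pairs q)"
    proof (intro equalityI subsetI)
      fix e assume "e \<in> moved_pairs p"
      then obtain v where v: "e = {v, p v}" "p v \<noteq> v" by (auto simp: moved_pairs_def)
      show "e \<in> insert {a, p a} (moved_pairs q)"
      proof (cases "v = a \<or> v = p a")
        case True
        then show ?thesis using v less.prems(2)[of a] by auto
      next
        case False
        then have "q v = p v" by (simp add: q)
        then show ?thesis using v unfolding moved_pairs_def by (intro insertI2 CollectI exI[of _ v]) simp
      qed
    next
      fix e assume "e \<in> insert {a, p a} (moved_pairs q)"
      then consider "e = {a, p a}" | v where "e = {v, q v}" "q v \<noteq> v"
        by (auto simp: moved_pairs_def)
      then show "e \<in> moved_pairs p"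
      proof cases
        case 1
        then show ?thesis using a by (auto simp: moved_pairs_def)
      next
        case 2
        then have "q v = p v" by (simp add: q split: if_splits)
        then show ?thesis using 2 unfolding moved_pairs_def by (intro CollectI exI[of _ v]) simp
      qed
    qed
    moreover have "{a, p a} \<notin> moved_pairs q"
    proof
      assume "{a, p a} \<in> moved_pairs q"
      then obtain v where v: "{a, p a} = {v, q v}" "q v \<noteq> v" by (auto simp: moved_pairs_def)
      then have "v = a \<or> v = p a" by blast
      then show False using v(2) by (simp add: q)
    qed
    ultimately have card_moved: "finite (moved_pairs p)"
        "card (moved_pairs p) = Suc (card (moved_pairs q))"
      using IH(1) by auto
    have "sign q = - sign p"
      unfolding q_def
      using sign_compose[OF permutation_swap_id permutes_imp_permutation[OF assms(1) less.prems(1)]] a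
      by (simp add: sign_swap_id)
    then show ?thesis using IH card_moved card_supp by simp
  qed
qed

text \<open>With k pairs, the 2k moved points contribute (-1)^(2k) = 1, the others contribute x
  each, and the sign is (-1)^k. The inequality ensures that the exponent does not truncate.\<close>

lemma perm_term_involution:
  assumes "finite V" "p permutes V" "\<And>v. p (p v) = v"
  shows "2 * card (moved_pairs p) \<le> card V"
    "perm_term V p = monom ((- 1) ^ card (moved_pairs p)) (card V - 2 * card (moved_pairs p))"
proof -
  define k where "k = card (moved_pairs p)"
  have k: "card {v. p v \<noteq> v} = 2 * k" "sign p = (- 1) ^ k"
    using involution_moved_pairs[OF assms] by (auto simp: k_def)
  have sub: "{v. p v \<noteq> v} \<subseteq> V" using assms(2) by (auto dest: permutes_not_in)
  show "2 * card (moved_pairs p) \<le> card V"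
    using card_mono[OF assms(1) sub] k by (simp add: k_def)
  have "(\<Prod>v\<in>V. if p v = v then [:0, 1:] else - 1 :: int poly) =
      (\<Prod>v\<in>V - {v. p v \<noteq> v}. [:0, 1:]) * (\<Prod>v\<in>{v. p v \<noteq> v}. - 1)"
    by (subst prod.subset_diff[OF sub assms(1)])
      (intro arg_cong2[where f = "(*)"] prod.cong; auto)
  also have "\<dots> = [:0, 1:] ^ (card V - 2 * k)"
    using sub assms(1) k(1) by (simp add: card_Diff_subset finite_subset)
  finally show "perm_term V p =
      monom ((- 1) ^ card (moved_pairs p)) (card V - 2 * card (moved_pairs p))"
    by (cases "even k")
      (simp_all add: perm_term_def k(2) k_def[symmetric] monom_altdef one_pCons)
qed

text \<open>The inverse map sends a matching to the involution that swaps the ends of each of its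
  edges and fixes all uncovered points.\<close>

lemma bij_betw_moved_pairs:
  assumes "simple_graph X"
  shows "bij_betw moved_pairs {p. graph_perm X p \<and> (\<forall>v. p (p v) = v)} {M. matching X M}"
proof (rule bij_betw_imageI)
  show "inj_on moved_pairs {p. graph_perm X p \<and> (\<forall>v. p (p v) = v)}"
  proof (rule inj_onI)
    \<comment> \<open>The pair through a point moved by \<open>p\<close> is also a pair of
      \<open>q\<close>, and it names the image of that point under both.\<close>
    have eq: "q v = p v"
      if "\<forall>v. p (p v) = v" "\<forall>v. q (q v) = v" "moved_pairs p = moved_pairs q" "p v \<noteq> v"
      for p q :: "'a \<Rightarrow> 'a" and v
    proof -
      have "{v, p v} \<in> moved_pairs q" using that(3,4) by (auto simp: moved_pairs_def)
      then obtain u where "{v, p v} = {u, q u}" by (auto simp: moved_pairs_def)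
      then show ?thesis using that(1,2) by (metis doubleton_eq_iff)
    qed
    fix p q assume pq: "p \<in> {p. graph_perm X p \<and> (\<forall>v. p (p v) = v)}"
      "q \<in> {p. graph_perm X p \<and> (\<forall>v. p (p v) = v)}" "moved_pairs p = moved_pairs q"
    show "p = q"
    proof
      fix v show "p v = q v"
      proof (cases "p v = v \<and> q v = v")
        case False
        \<comment> \<open>Both directions are used, since at first \<open>v\<close> is only known to
          be moved by one of the two involutions.\<close>
        then show ?thesis using eq[of p q v] eq[of q p v] pq by fastforce
      qed simp
    qed
  qed
  show "moved_pairs ` {p. graph_perm X p \<and> (\<forall>v. p (p v) = v)} = {M. matching X M}"
  proof (intro equalityI subsetI)
    fix M assume "M \<in> moved_pairs ` {p. graph_perm X p \<and> (\<forall>v. p (p v) = v)}"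
    then obtain p where p: "graph_perm X p" "\<And>v. p (p v) = v" "M = moved_pairs p" by auto
    have "M \<subseteq> edges X" using p(1) unfolding p(3) moved_pairs_def graph_perm_def by blast
    moreover have "e \<inter> f = {}" if "e \<in> M" "f \<in> M" "e \<noteq> f" for e f
    proof -
      obtain v w where "e = {v, p v}" "f = {w, p w}"
        using \<open>e \<in> M\<close> \<open>f \<in> M\<close> by (auto simp: p(3) moved_pairs_def)
      moreover have "{v, p v} = {w, p w}" if "v = w \<or> v = p w \<or> p v = w \<or> p v = p w"
        using that p(2)[of v] p(2)[of w] by (metis insert_commute)
      ultimately show ?thesis using \<open>e \<noteq> f\<close> by blast
    qed
    ultimately show "M \<in> {M. matching X M}" by (auto simp: matching_def)
  next
    fix M assume "M \<in> {M. matching X M}"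
    then have M: "M \<subseteq> edges X" "\<And>e f. e \<in> M \<Longrightarrow> f \<in> M \<Longrightarrow> e \<noteq> f \<Longrightarrow> e \<inter> f = {}"
      by (auto simp: matching_def)
    have edge: "u \<noteq> w \<and> u \<in> verts X \<and> w \<in> verts X" if "{u, w} \<in> M" for u w
    proof -
      have "card {u, w} = 2" "{u, w} \<subseteq> verts X"
        using that M(1) assms unfolding simple_graph_def by (blast, blast)
      then show ?thesis by (cases "u = w") auto
    qed
    have uniq: "w = w'" if "{u, w} \<in> M" "{u, w'} \<in> M" for u w w'
      using M(2)[OF that] by (auto simp: doubleton_eq_iff)
    \<comment> \<open>\<open>p\<close> sends a covered vertex to its partner, which is unique
      because edges of \<open>M\<close> sharing a vertex coincide.\<close>
    define p where "p = (\<lambda>u. if \<exists>w. {u, w} \<in> M then THE w. {u, w} \<in> M else u)"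
    have p1: "p u = w" if "{u, w} \<in> M" for u w
    proof -
      have "(THE w. {u, w} \<in> M) = w" using that uniq[OF _ that] by (rule the_equality)
      then show ?thesis using that by (auto simp: p_def)
    qed
    have p2: "p u = u" if "\<And>w. {u, w} \<notin> M" for u
      using that by (simp add: p_def)
    have p_p: "p (p u) = u" for u
    proof (cases "\<exists>w. {u, w} \<in> M")
      case True
      then obtain w where "{u, w} \<in> M" by blast
      then show ?thesis using p1[of u w] p1[of w u] by (simp add: insert_commute)
    next
      case False
      then show ?thesis using p2[of u] by simp
    qed
    have p3: "{u, p u} \<in> M" if "p u \<noteq> u" for u
      using that p1 p2 by metis
    have "p permutes verts X"
      unfolding permutes_def
    proof (intro conjI allI impI)
      show "p v = v" if "v \<notin> verts X" for v using that edge p2 by blast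
      show "\<exists>!u. p u = v" for v by (metis p_p)
    qed
    then have "graph_perm X p" using p3 M(1) by (auto simp: graph_perm_def)
    moreover have "moved_pairs p = M"
    proof (intro equalityI subsetI)
      fix e assume "e \<in> M"
      then have "card e = 2" using M(1) assms by (auto simp: simple_graph_def)
      then obtain u w where "e = {u, w}" by (auto simp: card_2_iff)
      then have "e = {u, p u}" "p u \<noteq> u" using \<open>e \<in> M\<close> p1[of u w] edge[of u w] by auto
      then show "e \<in> moved_pairs p" unfolding moved_pairs_def by blast
    next
      fix e assume "e \<in> moved_pairs p"
      then obtain u where "e = {u, p u}" "p u \<noteq> u" by (auto simp: moved_pairs_def)
      then show "e \<in> M" using p3[of u] by simp
    qed
    ultimately show "M \<in> moved_pairs ` {p. graph_perm X p \<and> (\<forall>v. p (p v) = v)}"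
      using p_p by (intro image_eqI[of _ _ p]) auto
  qed
qed

section \<open>Matching numbers and the matching polynomial\<close>

lemma finite_edges: "simple_graph X \<Longrightarrow> finite (edges X)"
  by (rule finite_subset[of _ "Pow (verts X)"]) (auto simp: simple_graph_def)

lemma finite_matching: "simple_graph X \<Longrightarrow> matching X M \<Longrightarrow> finite M"
  using finite_edges by (auto simp: matching_def intro: finite_subset)

lemma finite_matchings: "simple_graph X \<Longrightarrow> finite {M. matching X M}"
  by (rule finite_subset[of _ "Pow (edges X)"]) (auto simp: matching_def finite_edges)

text \<open>The involution belonging to \<open>M\<close> moves exactly \<open>2 * card M\<close>
  vertices.\<close>

lemma card_matching_le:
  assumes "simple_graph X" "matching X M"
  shows "2 * card M \<le> card (verts X)"
proof -
  obtain p where "graph_perm X p" "\<And>v. p (p v) = v" "M = moved_pairs p"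
  proof -
    have "M \<in> moved_pairs ` {p. graph_perm X p \<and> (\<forall>v. p (p v) = v)}"
      using bij_betw_imp_surj_on[OF bij_betw_moved_pairs[OF assms(1)]] assms(2) by simp
    then show ?thesis using that by blast
  qed
  then show ?thesis
    using perm_term_involution(1) assms(1) by (auto simp: graph_perm_def simple_graph_def)
qed

text \<open>The bijection turns the sum into one over matchings, which is then grouped by size; the
  size bound shows that the range of k in \<open>matching_poly\<close> captures all of them.\<close>

lemma sum_involutions:
  assumes "simple_graph X"
  shows "(\<Sum>p | graph_perm X p \<and> (\<forall>v. p (p v) = v). perm_term (verts X) p) = matching_poly X"
proof -
  define n where "n = card (verts X)"
  have fin: "finite (verts X)" using assms by (simp add: simple_graph_def)
  have "(\<Sum>p | graph_perm X p \<and> (\<forall>v. p (p v) = v). perm_term (verts X) p) =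
      (\<Sum>p | graph_perm X p \<and> (\<forall>v. p (p v) = v).
        monom ((- 1) ^ card (moved_pairs p)) (n - 2 * card (moved_pairs p)))"
    unfolding n_def
    by (intro sum.cong refl perm_term_involution(2) fin) (auto simp: graph_perm_def)
  also have "\<dots> = (\<Sum>M | matching X M. monom ((- 1) ^ card M) (n - 2 * card M))"
    by (rule sum.reindex_bij_betw[OF bij_betw_moved_pairs[OF assms]])
  also have "\<dots> = (\<Sum>k\<le>n div 2. \<Sum>M | M \<in> {M. matching X M} \<and> card M = k.
      monom ((- 1) ^ card M) (n - 2 * card M))"
  proof (rule sum.group[symmetric])
    show "card ` {M. matching X M} \<subseteq> {..n div 2}"
      using card_matching_le[OF assms] by (fastforce simp: n_def)
  qed (simp_all add: finite_matchings[OF assms])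
  also have "\<dots> = (\<Sum>k\<le>n div 2. monom ((- 1) ^ k * int (num_matchings X k)) (n - 2 * k))"
  proof (intro sum.cong refl)
    fix k
    have "{M. M \<in> {M. matching X M} \<and> card M = k} = {M. matching X M \<and> finite M \<and> card M = k}"
      using finite_matching[OF assms] by auto
    then show "(\<Sum>M | M \<in> {M. matching X M} \<and> card M = k.
        monom ((- 1) ^ card M) (n - 2 * card M)) =
        monom ((- 1) ^ k * int (num_matchings X k)) (n - 2 * k)"
      by (simp add: num_matchings_def of_nat_monom mult_monom mult_ac)
  qed
  finally show ?thesis by (simp add: matching_poly_def n_def)
qed

section \<open>Cycles\<close>

text \<open>A cycle on m points is a product of m - 1 transpositions.\<close>

lemma sign_cycle_of_list:
  "distinct cs \<Longrightarrow> sign (cycle_of_list cs) = (- 1) ^ (length cs - 1)"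
  by (induction cs rule: cycle_of_list.induct)
    (simp_all add: sign_compose permutation_swap_id permutation_of_cycle sign_swap_id del: o_apply)

lemma cycle_of_list_nth:
  assumes "distinct cs" "i < length cs"
  shows "cycle_of_list cs (cs ! i) = cs ! (Suc i mod length cs)"
proof -
  have "map (cycle_of_list cs) cs = rotate1 cs"
    using cyclic_rotation[OF assms(1), of 1] by simp
  then show ?thesis using assms(2) by (metis nth_map nth_rotate1)
qed

text \<open>Replaces the index arithmetic of \<open>cycle_graph\<close> by the successor permutation
  of the list.\<close>

lemma edges_cycle_graph:
  assumes "distinct cs"
  shows "edges (cycle_graph cs) = {{v, cycle_of_list cs v} | v. v \<in> set cs}"
  unfolding cycle_graph_def using cycle_of_list_nth[OF assms]
  by (auto simp: in_set_conv_nth)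

lemma cycle_of_list_in_set:
  "distinct cs \<Longrightarrow> v \<in> set cs \<Longrightarrow> cycle_of_list cs v \<in> set cs"
  using cycle_permutes permutes_in_image by metis

text \<open>Induction around a cycle: iterating the successor from any starting vertex reaches every
  vertex.\<close>

lemma cycle_of_list_induct:
  assumes "distinct cs" "a \<in> set cs" "P a" "b \<in> set cs"
    and step: "\<And>v. v \<in> set cs \<Longrightarrow> P v \<Longrightarrow> P (cycle_of_list cs v)"
  shows "P b"
proof -
  obtain i j where ij: "i < length cs" "a = cs ! i" "j < length cs" "b = cs ! j"
    using assms by (metis in_set_conv_nth)
  have "P (cs ! ((i + k) mod length cs))" for k
  proof (induction k)
    case 0
    then show ?case using ij assms(3) by simp
  next
    case (Suc k)
    have "(i + k) mod length cs < length cs" using ij by (intro mod_less_divisor) linarith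
    then show ?case
      using step[OF _ Suc] cycle_of_list_nth[OF assms(1)] by (simp add: mod_Suc_eq)
  qed
  \<comment> \<open>Adding \<open>length cs\<close> prevents truncation when j < i and does not
    change the index modulo the length.\<close>
  from this[of "j + length cs - i"] show ?thesis using ij by simp
qed

lemma cycle_of_list_twice:
  assumes "distinct cs" "3 \<le> length cs" "v \<in> set cs"
  shows "cycle_of_list cs (cycle_of_list cs v) \<noteq> v"
proof -
  define m where "m = length cs"
  obtain i where i: "i < m" "v = cs ! i"
    using assms(3) by (metis in_set_conv_nth m_def)
  have "Suc (Suc i mod m) mod m \<noteq> i"
    using i(1) assms(2) by (auto simp: mod_Suc m_def)
  moreover have "Suc (Suc i mod m) mod m < m" using i(1) by simp
  moreover have "cycle_of_list cs (cycle_of_list cs v) = cs ! (Suc (Suc i mod m) mod m)"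
    using cycle_of_list_nth[OF assms(1), folded m_def] i by simp
  ultimately show ?thesis
    using i assms(1) by (simp add: nth_eq_iff_index_eq m_def)
qed

text \<open>Each step of \<open>p\<close> goes forward or backward along the cycle. A backward step
  right after a forward one would give \<open>p (p v) = v\<close>, so one forward step forces all
  steps to be forward; without any forward step, all are backward.\<close>

lemma cycle_of_list_or_inverse:
  assumes cs: "distinct cs"
    and edge: "\<And>v. v \<in> set cs \<Longrightarrow> {v, p v} \<in> edges (cycle_graph cs)"
    and twice: "\<And>v. v \<in> set cs \<Longrightarrow> p (p v) \<noteq> v"
  shows "(\<forall>v\<in>set cs. p v = cycle_of_list cs v) \<or> (\<forall>v\<in>set cs. p v = inv_into UNIV (cycle_of_list cs) v)"
proof (cases "\<exists>a\<in>set cs. p a = cycle_of_list cs a")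
  case True
  define c where "c = cycle_of_list cs"
  have alt: "p v = c v \<or> c (p v) = v" if "v \<in> set cs" for v
    using edge[OF that] unfolding edges_cycle_graph[OF cs] c_def by (auto simp: doubleton_eq_iff)
  obtain a where a: "a \<in> set cs" "p a = c a" using True by (auto simp: c_def)
  have "p b = c b" if "b \<in> set cs" for b
  proof (rule cycle_of_list_induct[OF cs a(1), where P = "\<lambda>v. p v = c v"])
    fix v assume v: "v \<in> set cs" "p v = c v"
    have "c v \<in> set cs" unfolding c_def using cs v(1) by (rule cycle_of_list_in_set)
    then have "p (c v) = c (c v) \<or> c (p (c v)) = c v" by (rule alt)
    moreover have "inj c"
      unfolding c_def by (rule permutes_inj[OF cycle_permutes])
    ultimately show "p (cycle_of_list cs v) = c (cycle_of_list cs v)"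
      using twice[OF v(1)] v(2) by (auto simp: c_def dest: injD)
  qed (use a that in auto)
  then show ?thesis by (simp add: c_def)
next
  case False
  have "p v = inv_into UNIV (cycle_of_list cs) v" if "v \<in> set cs" for v
  proof -
    have "cycle_of_list cs (p v) = v"
      using edge[OF that] False that unfolding edges_cycle_graph[OF cs]
      by (auto simp: doubleton_eq_iff)
    then show ?thesis
      by (metis cycle_permutes permutes_inv_eq)
  qed
  then show ?thesis by blast
qed

text \<open>\<open>support p v\<close> lists the orbit of \<open>v\<close>, on which
  \<open>p\<close> is the successor permutation, so consecutive orbit points are joined by edges of
  \<open>X\<close>. Injectivity of the powers of \<open>p\<close> carries
  \<open>p (p v) \<noteq> v\<close> to the whole orbit.\<close>

lemma cycle_of_support:
  assumes "simple_graph X" "graph_perm X p" "p (p v) \<noteq> v"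
  shows "cycle_of (cycle_graph (support p v)) X" "v \<in> set (support p v)"
    "\<And>w. w \<in> set (support p v) \<Longrightarrow> {w, p w} \<in> edges (cycle_graph (support p v))"
    "\<And>w. w \<in> set (support p v) \<Longrightarrow> p (p w) \<noteq> w"
proof -
  define cs where "cs = support p v"
  have per: "p permutes verts X" using assms(2) by (simp add: graph_perm_def)
  have perm: "permutation p"
    using assms(1) per by (auto simp: simple_graph_def intro: permutes_imp_permutation)
  have cs: "distinct cs" unfolding cs_def using perm by (rule cycle_of_permutation)
  have orbit: "set cs = range (\<lambda>i. (p ^^ i) v)" unfolding cs_def using perm by (rule support_set)
  show v: "v \<in> set (support p v)" using orbit unfolding cs_def by (metis funpow_0 rangeI)
  have inj: "inj p" using per by (rule permutes_inj)
  have twice: "p (p w) \<noteq> w" if "w \<in> set cs" for w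
  proof -
    obtain i where i: "w = (p ^^ i) v" using \<open>w \<in> set cs\<close> orbit by auto
    have "inj (p ^^ i)" using inj by (rule inj_fn)
    moreover have "p (p w) = (p ^^ i) (p (p v))"
      unfolding i by (simp add: funpow_swap1)
    ultimately show ?thesis using assms(3) i by (auto dest: injD)
  qed
  have edges: "edges (cycle_graph cs) = {{w, p w} | w. w \<in> set cs}"
    using cycle_restrict[OF perm, of _ v]
    unfolding edges_cycle_graph[OF cs] by (auto simp: cs_def)
  have "length cs \<noteq> 0" using v by (auto simp: cs_def)
  moreover have "(p ^^ length cs) v = v"
    using least_power_of_permutation(1)[OF perm] by (simp add: cs_def)
  moreover have "p v \<noteq> v" using assms(3) by auto
  \<comment> \<open>Orbit lengths 1 and 2 are excluded by \<open>p v \<noteq> v\<close> and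
    \<open>p (p v) \<noteq> v\<close>.\<close>
  ultimately have "3 \<le> length cs"
    using assms(3)
    by (cases "length cs"; cases "length cs - 1"; cases "length cs - 2") (auto simp: numeral_eq_Suc)
  moreover have "set cs \<subseteq> verts X"
  proof -
    have "v \<in> verts X" using \<open>p v \<noteq> v\<close> per by (metis permutes_not_in)
    then show ?thesis
      unfolding orbit using permutes_in_image[OF permutes_funpow[OF per]] by auto
  qed
  moreover have "edges (cycle_graph cs) \<subseteq> edges X"
  proof
    fix e assume "e \<in> edges (cycle_graph cs)"
    then obtain w where "w \<in> set cs" "e = {w, p w}" by (auto simp: edges)
    then show "e \<in> edges X"
      using assms(2) twice[of w] unfolding graph_perm_def by metis
  qed
  ultimately show "cycle_of (cycle_graph (support p v)) X"
    using cs unfolding cycle_of_def by (fold cs_def) (auto simp: cycle_graph_def)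
  show "\<And>w. w \<in> set (support p v) \<Longrightarrow> {w, p w} \<in> edges (cycle_graph (support p v))"
    "\<And>w. w \<in> set (support p v) \<Longrightarrow> p (p w) \<noteq> w"
    using edges twice by (fold cs_def) auto
qed


section \<open>Characteristic polynomials of forests and of graphs with one cycle\<close>

text \<open>A point with \<open>p (p v) \<noteq> v\<close> would yield a cycle, so only the
  involutions occur in the sum.\<close>

theorem graph_char_poly_forest:
  assumes "simple_graph X" "forest X"
  shows "graph_char_poly X = matching_poly X"
proof -
  have "{p. graph_perm X p} = {p. graph_perm X p \<and> (\<forall>v. p (p v) = v)}"
    using cycle_of_support(1)[OF assms(1)] assms(2) by (auto simp: forest_def)
  then show ?thesis
    using graph_char_poly_eq_sum_perms[OF assms(1)] sum_involutions[OF assms(1)] by simp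
qed

lemma simple_graph_delete_verts: "simple_graph X \<Longrightarrow> simple_graph (delete_verts X S)"
  by (auto simp: simple_graph_def delete_verts_def)

text \<open>In either direction a cycle of length m has sign (-1)^(m - 1), and its m moved vertices
  contribute (-1)^m; the product is -1 whatever the parity of m.\<close>

lemma perm_term_cycle:
  assumes "distinct cs" "3 \<le> length cs" "d \<in> {cycle_of_list cs, inv_into UNIV (cycle_of_list cs)}"
  shows "perm_term (set cs) d = - 1"
proof -
  define c where "c = cycle_of_list cs"
  have c: "c permutes set cs" unfolding c_def by (rule cycle_permutes)
  have moved: "c v \<noteq> v" "inv_into UNIV c v \<noteq> v" if "v \<in> set cs" for v
    using cycle_of_list_twice[OF assms(1,2) that] permutes_inv_eq[OF c, of v v]
    by (auto simp: c_def)
  have "sign d = (- 1) ^ (length cs - 1)"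
    using assms(1,3) sign_cycle_of_list[of cs] by (auto simp: sign_inverse permutation_of_cycle)
  moreover have "(\<Prod>v\<in>set cs. if d v = v then [:0, 1:] else - 1 :: int poly) = (- 1) ^ length cs"
    using moved assms(3) by (auto simp: c_def distinct_card[OF assms(1)] cong: prod.cong)
  moreover have "(- 1 :: int poly) ^ (length cs - 1) * (- 1) ^ length cs = - 1"
    using assms(2) by (cases "length cs") (auto simp flip: power_add mult_2)
  ultimately show ?thesis by (simp add: perm_term_def)
qed

text \<open>A non-involution has an orbit that traces the unique cycle, on which it is one of the
  two rotations \<open>d\<close>. Cancelling \<open>d\<close> leaves an involution that lives off
  the cycle.\<close>

lemma bij_betw_noninvolutions:
  assumes X: "simple_graph X" and uniq: "\<And>C'. cycle_of C' X \<longleftrightarrow> C' = cycle_graph cs"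
    and cs: "distinct cs" "3 \<le> length cs"
  shows "bij_betw (\<lambda>(d, q). d \<circ> q)
    ({cycle_of_list cs, inv_into UNIV (cycle_of_list cs)} \<times>
      {q. graph_perm (delete_verts X (set cs)) q \<and> (\<forall>v. q (q v) = v)})
    {p. graph_perm X p \<and> \<not> (\<forall>v. p (p v) = v)}"
    (is "bij_betw ?f (?D \<times> ?Q) ?P")
proof (rule bij_betw_imageI)
  define c where "c = cycle_of_list cs"
  have c: "c permutes set cs" unfolding c_def by (rule cycle_permutes)
  have ic: "inv_into UNIV c permutes set cs" using c by (rule permutes_inv)
  have D: "?D = {c, inv_into UNIV c}" by (simp add: c_def)
  have perD: "d permutes set cs" if "d \<in> ?D" for d using that c ic by (auto simp: D)
  have sub: "set cs \<subseteq> verts X" "edges (cycle_graph cs) \<subseteq> edges X"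
    using uniq[of "cycle_graph cs"] by (auto simp: cycle_of_def cycle_graph_def)
  have perQ: "q permutes verts X - set cs" if "q \<in> ?Q" for q
    using that by (auto simp: graph_perm_def delete_verts_def)
  have nonempty: "hd cs \<in> set cs" using cs(2) by (cases cs) auto
  show "inj_on ?f (?D \<times> ?Q)"
  proof (rule inj_onI)
    fix x y assume xy: "x \<in> ?D \<times> ?Q" "y \<in> ?D \<times> ?Q" "?f x = ?f y"
    obtain d q d' q' where eq: "x = (d, q)" "y = (d', q')" by (cases x, cases y)
    have *: "d \<in> ?D" "q \<in> ?Q" "d' \<in> ?D" "q' \<in> ?Q" "d \<circ> q = d' \<circ> q'"
      using xy unfolding eq by (simp_all only: mem_Sigma_iff case_prod_conv)
    have "d v = d' v" for v
    proof (cases "v \<in> set cs")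
      case True
      then have "q v = v" "q' v = v"
        using perQ[OF *(2)] perQ[OF *(4)] by (auto dest: permutes_not_in)
      then show ?thesis using fun_cong[OF *(5), of v] by simp
    next
      case False
      then show ?thesis using perD[OF *(1)] perD[OF *(3)] by (simp add: permutes_not_in)
    qed
    then have "d = d'" by blast
    moreover have "q v = q' v" for v
      using fun_cong[OF *(5), of v] permutes_inj[OF perD[OF *(1)]] \<open>d = d'\<close> by (auto dest: injD)
    ultimately show "x = y" unfolding eq by blast
  qed
  show "?f ` (?D \<times> ?Q) = ?P"
  proof (intro equalityI subsetI)
    fix p assume "p \<in> ?f ` (?D \<times> ?Q)"
    then obtain d q where p: "p = d \<circ> q" "d \<in> ?D" "q \<in> ?Q" by auto
    have on: "p v = d v" if "v \<in> set cs" for v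
      using that perQ[OF p(3)] by (simp add: p(1) permutes_not_in)
    have off: "p v = q v" if "v \<notin> set cs" for v
    proof -
      have "q v \<notin> set cs"
        using that permutes_in_image[OF perQ[OF p(3)], of v] permutes_not_in[OF perQ[OF p(3)], of v]
        by (cases "v \<in> verts X") auto
      then show ?thesis using perD[OF p(2)] by (simp add: p(1) permutes_not_in)
    qed
    have cyc_edge: "{v, d v} \<in> edges (cycle_graph cs)" if "v \<in> set cs" for v
    proof (cases "d = c")
      case True
      then show ?thesis using that edges_cycle_graph[OF cs(1)] by (auto simp: c_def)
    next
      case False
      then have d: "d = inv_into UNIV c" using p(2) by (simp add: D)
      have "inv_into UNIV c v \<in> set cs" using that permutes_in_image[OF ic] by blast
      moreover have "c (inv_into UNIV c v) = v" using permutes_inverses(1)[OF c] .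
      ultimately show ?thesis
        unfolding d edges_cycle_graph[OF cs(1)] c_def
        by (intro CollectI exI[of _ "inv_into UNIV (cycle_of_list cs) v"]) (simp add: insert_commute)
    qed
    have "p permutes verts X"
      unfolding p(1) using perD[OF p(2)] perQ[OF p(3)] sub(1)
      by (intro permutes_compose) (auto intro: permutes_subset)
    moreover have "{v, p v} \<in> edges X" if "p v \<noteq> v" for v
    proof (cases "v \<in> set cs")
      case True
      then show ?thesis using cyc_edge[OF True] on[OF True] sub(2) by auto
    next
      case False
      then show ?thesis
        using that p(3) off[OF False] by (auto simp: graph_perm_def delete_verts_def)
    qed
    \<comment> \<open>Any vertex of the cycle witnesses that \<open>p\<close> is not an involution;
      \<open>hd cs\<close> is one.\<close>
    moreover have "p (p (hd cs)) \<noteq> hd cs"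
    proof -
      have tw: "c (c (hd cs)) \<noteq> hd cs"
        unfolding c_def using cs nonempty by (rule cycle_of_list_twice)
      have "d (hd cs) \<in> set cs" using permutes_in_image[OF perD[OF p(2)]] nonempty by blast
      then have "p (p (hd cs)) = d (d (hd cs))" using on nonempty by simp
      then show ?thesis using tw p(2) permutes_inverses(1)[OF c] unfolding D by (metis insertE singletonD)
    qed
    ultimately show "p \<in> ?P" by (auto simp: graph_perm_def)
  next
    fix p assume "p \<in> ?P"
    then obtain v0 where p: "graph_perm X p" "p (p v0) \<noteq> v0" by auto
    have per: "p permutes verts X" using p(1) by (simp add: graph_perm_def)
    \<comment> \<open>The orbit list may be a rotation or a reversal of \<open>cs\<close>;
      uniqueness identifies the cycle graphs, hence the vertex sets.\<close>
    have supp: "cycle_graph (support p v) = cycle_graph cs" if "p (p v) \<noteq> v" for v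
      using cycle_of_support(1)[OF X p(1) that] uniq by blast
    then have set_supp: "set (support p v) = set cs" if "p (p v) \<noteq> v" for v
      using that unfolding cycle_graph_def by blast
    have edge: "{w, p w} \<in> edges (cycle_graph cs)" and twice: "p (p w) \<noteq> w" if "w \<in> set cs" for w
      using cycle_of_support(3,4)[OF X p, unfolded set_supp[OF p(2)] supp[OF p(2)]] that by auto
    have invol: "p (p w) = w" if "w \<notin> set cs" for w
      using cycle_of_support(2)[OF X p(1), of w] set_supp[of w] that by blast
    obtain d where d: "d \<in> ?D" "\<And>v. v \<in> set cs \<Longrightarrow> p v = d v"
      using cycle_of_list_or_inverse[OF cs(1) edge twice] by blast
    have id: "inv_into UNIV d permutes set cs" using perD[OF d(1)] by (rule permutes_inv)
    define q where "q = inv_into UNIV d \<circ> p"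
    have q_on: "q v = v" if "v \<in> set cs" for v
      using d(2)[OF that] permutes_inverses(2)[OF perD[OF d(1)]] by (simp add: q_def)
    \<comment> \<open>If \<open>p v\<close> were on the cycle, then so would be
      \<open>p (p v)\<close>, which equals \<open>v\<close>.\<close>
    have p_off: "p v \<notin> set cs" if "v \<notin> set cs" for v
      using permutes_in_image[OF perD[OF d(1)], of "p v"] d(2)[of "p v"] invol[OF that] that by metis
    have q_off: "q v = p v" if "v \<notin> set cs" for v
      using p_off[OF that] id by (simp add: q_def permutes_not_in)
    have "q permutes verts X"
      unfolding q_def using per id sub(1) by (intro permutes_compose) (auto intro: permutes_subset)
    then have "q permutes verts X - set cs"
      by (rule permutes_superset) (use q_on in auto)
    moreover have "{v, q v} \<in> edges (delete_verts X (set cs))" if "q v \<noteq> v" for v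
    proof -
      have "v \<notin> set cs" using that q_on by blast
      then show ?thesis
        using that q_off p_off p(1) by (auto simp: graph_perm_def delete_verts_def)
    qed
    moreover have "q (q v) = v" for v
      using q_on q_off p_off invol by (cases "v \<in> set cs") auto
    ultimately have "q \<in> ?Q" by (auto simp: graph_perm_def delete_verts_def)
    moreover have "p = d \<circ> q"
      unfolding q_def using permutes_inv_o(1)[OF perD[OF d(1)]] by (simp add: o_assoc)
    ultimately show "p \<in> ?f ` (?D \<times> ?Q)" using d(1) by auto
  qed
qed

text \<open>Stated for an arbitrary simple graph with exactly one cycle, so that it covers both
  \<open>U\<close> and the disconnected \<open>H\<close>.\<close>

theorem graph_char_poly_one_cycle:
  assumes X: "simple_graph X" and uniq: "\<And>C'. cycle_of C' X \<longleftrightarrow> C' = C"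
  shows "graph_char_poly X = matching_poly X - 2 * matching_poly (delete_verts X (verts C))"
proof -
  obtain cs where cs: "distinct cs" "3 \<le> length cs" "C = cycle_graph cs" and sub: "verts C \<subseteq> verts X"
    using uniq[of C] by (auto simp: cycle_of_def)
  have vC: "verts C = set cs" by (simp add: cs(3) cycle_graph_def)
  define Y where "Y = delete_verts X (set cs)"
  define c where "c = cycle_of_list cs"
  define Q where "Q = {q. graph_perm Y q \<and> (\<forall>v. q (q v) = v)}"
  have Y: "simple_graph Y" "verts Y = verts X - set cs"
    using simple_graph_delete_verts[OF X] by (auto simp: Y_def delete_verts_def)
  have fin: "finite (verts X)" using X by (simp add: simple_graph_def)
  have c: "c permutes set cs" unfolding c_def by (rule cycle_permutes)
  \<comment> \<open>The two directions are different permutations; this is where the factor 2 comes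
    from.\<close>
  have "c \<noteq> inv_into UNIV c"
  proof
    assume "c = inv_into UNIV c"
    then have "c (c (hd cs)) = hd cs" using permutes_inverses(1)[OF c, of "hd cs"] by simp
    moreover have "hd cs \<in> set cs" using cs(2) by (cases cs) auto
    ultimately show False using cycle_of_list_twice[OF cs(1,2)] by (simp add: c_def)
  qed
  have "(\<Sum>p | graph_perm X p \<and> \<not> (\<forall>v. p (p v) = v). perm_term (verts X) p) =
      (\<Sum>(d, q)\<in>{c, inv_into UNIV c} \<times> Q. perm_term (verts X) (d \<circ> q))"
    using sum.reindex_bij_betw[OF bij_betw_noninvolutions[OF X uniq[unfolded cs(3)] cs(1,2)],
        of "perm_term (verts X)"]
    by (simp add: case_prod_unfold c_def Q_def Y_def)
  also have "\<dots> = (\<Sum>(d, q)\<in>{c, inv_into UNIV c} \<times> Q. - perm_term (verts Y) q)"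
  proof (intro sum.cong refl, clarsimp simp only: mem_Sigma_iff case_prod_conv split_paired_all)
    fix d q assume dq: "d \<in> {c, inv_into UNIV c}" "q \<in> Q"
    have "d permutes set cs" using dq(1) c permutes_inv[OF c] by auto
    moreover have "q permutes verts X - set cs"
      using dq(2) Y(2) by (auto simp: Q_def graph_perm_def)
    ultimately show "perm_term (verts X) (d \<circ> q) = - perm_term (verts Y) q"
      using perm_term_compose[OF fin sub[unfolded vC]] perm_term_cycle[OF cs(1,2) dq(1)[unfolded c_def]]
      by (simp add: Y(2))
  qed
  also have "\<dots> = - 2 * (\<Sum>q\<in>Q. perm_term (verts Y) q)"
    using \<open>c \<noteq> inv_into UNIV c\<close> by (simp add: sum.cartesian_product[symmetric] sum_negf)
  also have "\<dots> = - 2 * matching_poly Y"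
    unfolding Q_def by (simp only: sum_involutions[OF Y(1)])
  finally have *: "(\<Sum>p | graph_perm X p \<and> \<not> (\<forall>v. p (p v) = v). perm_term (verts X) p) =
      - 2 * matching_poly Y" .
  have "graph_char_poly X = (\<Sum>p | graph_perm X p \<and> (\<forall>v. p (p v) = v). perm_term (verts X) p) +
      (\<Sum>p | graph_perm X p \<and> \<not> (\<forall>v. p (p v) = v). perm_term (verts X) p)"
    unfolding graph_char_poly_eq_sum_perms[OF X]
    using finite_graph_perms[OF fin]
    by (subst sum.union_disjoint[symmetric]) (auto intro: sum.cong finite_subset)
  then show ?thesis unfolding * sum_involutions[OF X] vC Y_def by simp
qed

section \<open>Disjoint unions and coefficients\<close>

lemma simple_graph_union:
  "simple_graph X \<Longrightarrow> simple_graph Y \<Longrightarrow> simple_graph (graph_union X Y)"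
  by (auto simp: simple_graph_def graph_union_def)

text \<open>A walk around the cycle never leaves \<open>X\<close>: an edge at a vertex of
  \<open>X\<close> cannot belong to \<open>Y\<close>, as the vertex sets are disjoint.\<close>

lemma cycle_of_component:
  assumes "distinct cs" "3 \<le> length cs" "a \<in> set cs" "a \<in> verts X"
    and "edges (cycle_graph cs) \<subseteq> edges X \<union> edges Y"
    and "simple_graph X" "simple_graph Y" "verts X \<inter> verts Y = {}"
  shows "cycle_of (cycle_graph cs) X"
proof -
  have edge: "c \<in> verts X \<and> {v, c} \<in> edges X"
    if "v \<in> set cs" "v \<in> verts X" "c = cycle_of_list cs v" for v c
  proof -
    have "{v, c} \<in> edges X \<union> edges Y"
      using assms(5) that unfolding edges_cycle_graph[OF assms(1)] by blast
    moreover have "{v, c} \<notin> edges Y"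
      using assms(7,8) that(2) unfolding simple_graph_def by blast
    ultimately show ?thesis using assms(6) unfolding simple_graph_def by blast
  qed
  have verts: "b \<in> verts X" if "b \<in> set cs" for b
    by (rule cycle_of_list_induct[OF assms(1,3), where P = "\<lambda>v. v \<in> verts X"])
      (use assms(4) that edge in blast)+
  have "edges (cycle_graph cs) \<subseteq> edges X"
    unfolding edges_cycle_graph[OF assms(1)] using edge verts by blast
  then show ?thesis
    using assms(1,2) verts unfolding cycle_of_def by (auto simp: cycle_graph_def)
qed

lemma cycle_of_graph_union:
  assumes "simple_graph X" "simple_graph Y" "verts X \<inter> verts Y = {}"
  shows "cycle_of C (graph_union X Y) \<longleftrightarrow> cycle_of C X \<or> cycle_of C Y"
proof
  assume C: "cycle_of C (graph_union X Y)"
  then obtain cs where cs: "distinct cs" "3 \<le> length cs" "C = cycle_graph cs"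
    by (auto simp: cycle_of_def)
  have sub: "set cs \<subseteq> verts X \<union> verts Y" "edges (cycle_graph cs) \<subseteq> edges X \<union> edges Y"
    using C unfolding cs(3) by (auto simp: cycle_of_def graph_union_def cycle_graph_def)
  obtain a where a: "a \<in> set cs" using cs(2) by (cases cs) auto
  then consider "a \<in> verts X" | "a \<in> verts Y" using sub(1) by blast
  then show "cycle_of C X \<or> cycle_of C Y"
  proof cases
    case 1
    then show ?thesis using cycle_of_component[OF cs(1,2) a 1 sub(2) assms] cs(3) by simp
  next
    case 2
    have "edges (cycle_graph cs) \<subseteq> edges Y \<union> edges X" using sub(2) by blast
    from cycle_of_component[OF cs(1,2) a 2 this assms(2,1)] assms(3) show ?thesis
      by (simp add: cs(3) Int_commute)
  qed
qed (auto simp: cycle_of_def graph_union_def)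

lemma delete_verts_graph_union:
  assumes "simple_graph X" "verts X \<inter> S = {}"
  shows "delete_verts (graph_union X Y) S = graph_union X (delete_verts Y S)"
proof -
  have "e \<inter> S = {}" if "e \<in> edges X" for e
    using assms that unfolding simple_graph_def by blast
  then show ?thesis using assms(2) by (auto simp: delete_verts_def graph_union_def)
qed

text \<open>Nonemptiness is recorded so that, for \<open>S = verts C\<close>, the cycle
  \<open>C\<close> itself is ruled out.\<close>

lemma cycle_of_delete_verts:
  "cycle_of C (delete_verts X S) \<Longrightarrow> cycle_of C X \<and> verts C \<inter> S = {} \<and> verts C \<noteq> {}"
  by (auto simp: cycle_of_def delete_verts_def cycle_graph_def)

section \<open>From spectra to integer characteristic polynomials\<close>

lemma adj_matrix_carrier:
  assumes "simple_graph X"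
  shows "adj_matrix X \<in> carrier_mat (card (verts X)) (card (verts X))"
proof -
  have "length (vertex_list X) = card (verts X)"
    using vertex_list[of X] assms by (metis distinct_card simple_graph_def)
  then show ?thesis by (simp add: adj_matrix_def adj_matrix_wrt_def)
qed

lemma degree_graph_char_poly: "simple_graph X \<Longrightarrow> degree (graph_char_poly X) = card (verts X)"
  unfolding graph_char_poly_def using degree_monic_char_poly[OF adj_matrix_carrier] by blast

text \<open>Over the complex numbers a monic polynomial is the product of the linear factors of its
  roots with multiplicity, and the embedding of integer polynomials is injective.\<close>

lemma graph_char_poly_eq_if_adj_spectrum_eq:
  assumes "simple_graph X" "simple_graph Y" "adj_spectrum X = adj_spectrum Y"
  shows "graph_char_poly X = graph_char_poly Y"
proof -
  have complex: "map_poly of_int (graph_char_poly Z) = (\<Prod>x\<in>#adj_spectrum Z. [:- x, 1:])"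
    if "simple_graph Z" for Z :: "'z graph"
  proof -
    define A where "A = (adj_matrix Z :: complex mat)"
    have "A = map_mat of_int (adj_matrix Z)"
      by (rule eq_matI) (auto simp: A_def adj_matrix_def adj_matrix_wrt_def)
    then have "map_poly of_int (graph_char_poly Z) = char_poly A"
      by (simp add: graph_char_poly_def of_int_hom.char_poly_hom[OF adj_matrix_carrier[OF that]])
    moreover have "lead_coeff (char_poly A) = 1"
      unfolding A_def using degree_monic_char_poly[OF adj_matrix_carrier[OF that]] by metis
    ultimately show ?thesis
      using complex_poly_decompose_multiset[of "char_poly A"] by (simp add: adj_spectrum_def A_def)
  qed
  have "map_poly of_int (graph_char_poly X) = (map_poly of_int (graph_char_poly Y) :: complex poly)"
    using complex[OF assms(1)] complex[OF assms(2)] assms(3) by simp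
  then show ?thesis by simp
qed

section \<open>Coefficients and matching numbers\<close>

lemma coeff_matching_poly:
  assumes "2 * k \<le> card (verts X)"
  shows "coeff (matching_poly X) (card (verts X) - 2 * k) = (- 1) ^ k * int (num_matchings X k)"
proof -
  define n where "n = card (verts X)"
  \<comment> \<open>In the range 2j \<le> n the exponents n - 2j are pairwise distinct, so only j =
    k contributes.\<close>
  have "coeff (matching_poly X) (n - 2 * k) =
      (\<Sum>j\<le>n div 2. if j = k then (- 1) ^ j * int (num_matchings X j) else 0)"
    unfolding matching_poly_def n_def[symmetric] coeff_sum coeff_monom
    using assms by (intro sum.cong refl) (auto simp: n_def)
  also have "\<dots> = (- 1) ^ k * int (num_matchings X k)"
    using assms by (simp add: sum.delta n_def)
  finally show ?thesis by (simp add: n_def)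
qed

lemma num_matchings_eq_0:
  assumes "simple_graph X" "card (verts X) < 2 * k"
  shows "num_matchings X k = 0"
proof -
  have "{M. matching X M \<and> finite M \<and> card M = k} = {}"
    using card_matching_le[OF assms(1)] assms(2) by fastforce
  then show ?thesis unfolding num_matchings_def by (simp only: card.empty)
qed

lemma num_matchings_0: "num_matchings X 0 = 1"
proof -
  have "{M. matching X M \<and> finite M \<and> card M = 0} = {{}}" by (auto simp: matching_def)
  then show ?thesis unfolding num_matchings_def by simp
qed

theorem theorem4p5:
  fixes T :: "'t graph" and H R U F C :: "'a graph" and l :: nat
  assumes "simple_graph T" and "tree T"
    and "main_factor_multiplicity T = 2"
    and "simple_graph R" and "tree R"
    and "simple_graph U" and "unicyclic U" and "bipartite U"
    and "verts R \<inter> verts U = {}" and "H = graph_union R U"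
    and "\<not> graph_connected H"
    and "generalized_cospectral H T"
    and "cycle_of C U" and "card (verts C) = 2 * l" and "2 \<le> l"
    and "F = delete_verts U (verts C)"
  shows "forest F \<and>
    graph_char_poly U = matching_poly U - 2 * matching_poly F \<and>
    (\<forall>k. int (num_matchings T k) = int (num_matchings H k)
       - 2 * (-1) ^ l * (if k < l then 0 else int (num_matchings (graph_union R F) (k - l)))) \<and>
    (\<forall>k<l. num_matchings T k = num_matchings H k) \<and>
    int (num_matchings T l) - int (num_matchings H l) = - 2 * (-1) ^ l"
proof -
  define G where "G = graph_union R F"
  have uniqU: "cycle_of C' U \<longleftrightarrow> C' = C" for C'
    using assms(7,13) by (auto simp: unicyclic_def)
  have forests: "forest T" "forest R" using assms(2,5) by (auto simp: tree_def)
  have CU: "verts C \<subseteq> verts U" using assms(13) by (simp add: cycle_of_def)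
  have simple: "simple_graph F" "simple_graph H" "simple_graph G"
    using assms(4,6,10,16) by (simp_all add: simple_graph_delete_verts simple_graph_union G_def)
  have "\<not> cycle_of C' F" for C'
    using cycle_of_delete_verts[of C' U "verts C"] uniqU assms(16) by auto
  then have "forest F" by (simp add: forest_def)
  have \<phi>U: "graph_char_poly U = matching_poly U - 2 * matching_poly F"
    unfolding assms(16) using assms(6) uniqU by (rule graph_char_poly_one_cycle)
  have uniqH: "cycle_of C' H \<longleftrightarrow> C' = C" for C'
    using cycle_of_graph_union[OF assms(4,6,9)] uniqU forests(2)
    by (auto simp: assms(10) forest_def)
  have "delete_verts H (verts C) = G"
    unfolding assms(10,16) G_def using assms(4,9) CU by (intro delete_verts_graph_union) auto
  then have \<phi>H: "graph_char_poly H = matching_poly H - 2 * matching_poly G"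
    using graph_char_poly_one_cycle[OF simple(2) uniqH] by simp
  have \<phi>T: "graph_char_poly H = graph_char_poly T"
    using assms(12) simple(2) assms(1)
    by (intro graph_char_poly_eq_if_adj_spectrum_eq) (simp_all add: generalized_cospectral_def)
  define n where "n = card (verts H)"
  \<comment> \<open>The number of vertices is the degree of the common characteristic
    polynomial.\<close>
  have nT: "card (verts T) = n"
    using degree_graph_char_poly[OF assms(1)] degree_graph_char_poly[OF simple(2)] \<phi>T
    by (simp add: n_def)
  have fin: "finite (verts H)" using simple(2) by (simp add: simple_graph_def)
  have "verts G = verts H - verts C" "verts C \<subseteq> verts H"
    using CU assms(9) by (auto simp: G_def assms(10,16) graph_union_def delete_verts_def)
  then have nG: "card (verts G) = n - 2 * l" "2 * l \<le> n"
    using fin assms(14) card_mono[OF fin, of "verts C"]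
    by (auto simp: n_def card_Diff_subset finite_subset)
  have poly: "matching_poly T = matching_poly H - 2 * matching_poly G"
    using \<phi>H \<phi>T graph_char_poly_forest[OF assms(1) forests(1)] by simp
  have main: "int (num_matchings T k) = int (num_matchings H k)
      - 2 * (- 1) ^ l * (if k < l then 0 else int (num_matchings G (k - l)))" for k
  proof (cases "2 * k \<le> n")
    \<comment> \<open>For 2k > n \<ge> 2l also 2(k - l) > n - 2l, so all three matching numbers
      vanish.\<close>
    case False
    then show ?thesis
      using nT nG num_matchings_eq_0[OF assms(1), of k] num_matchings_eq_0[OF simple(2), of k]
        num_matchings_eq_0[OF simple(3), of "k - l"]
      by (simp add: n_def)
  next
    case True
    \<comment> \<open>\<open>e\<close> is the sign of a k-matching in the matching polynomial,
      \<open>e * s\<close> that of a (k - l)-matching, and \<open>g\<close> encodes the convention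
      for negative indices.\<close>
    define e s g where "e = (- 1 :: int) ^ k" and "s = (- 1 :: int) ^ l"
      and "g = (if k < l then 0 else int (num_matchings G (k - l)))"
    have "coeff (matching_poly T) (n - 2 * k) = e * int (num_matchings T k)"
      using coeff_matching_poly[of k T] True nT by (simp add: e_def)
    moreover have "coeff (matching_poly H) (n - 2 * k) = e * int (num_matchings H k)"
      using coeff_matching_poly[of k H] True by (simp add: n_def e_def)
    moreover have "coeff (matching_poly G) (n - 2 * k) = e * s * g"
    proof (cases "k < l")
      case True
      \<comment> \<open>For k < l the exponent n - 2k exceeds n - 2l, the largest exponent that
        \<open>matching_poly G\<close> can have.\<close>
      have "degree (matching_poly G) \<le> n - 2 * l"
        unfolding matching_poly_def nG(1)[symmetric]
        by (intro degree_sum_le) (auto intro: order_trans[OF degree_monom_le])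
      then show ?thesis using True nG(2) by (simp add: coeff_eq_0 g_def)
    next
      case False
      then obtain j where j: "k = l + j" by (metis le_add_diff_inverse not_less)
      have "e * s = (- 1) ^ j"
        by (simp add: e_def s_def j power_add mult_ac flip: power_mult_distrib)
      \<comment> \<open>With k = l + j, the exponent n - 2k equals (n - 2l) - 2j, so the coefficient
        counts the j-matchings of \<open>G\<close>.\<close>
      then show ?thesis
        using coeff_matching_poly[of j G] nG \<open>2 * k \<le> n\<close> by (simp add: j g_def)
    qed
    moreover have "coeff (2 * matching_poly G) m = 2 * coeff (matching_poly G) m" for m
      by (simp only: mult_2 coeff_add)
    ultimately have "e * int (num_matchings T k) = e * (int (num_matchings H k) - 2 * s * g)"
      unfolding poly coeff_diff by (simp only: right_diff_distrib mult_ac)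
    moreover have "e \<noteq> 0" by (simp add: e_def)
    ultimately show ?thesis by (simp add: s_def g_def)
  qed
  have "num_matchings T k = num_matchings H k" if "k < l" for k
    using main[of k] that by simp
  moreover have "int (num_matchings T l) - int (num_matchings H l) = - 2 * (- 1) ^ l"
    \<comment> \<open>At k = l the correction term counts only the empty matching of
      \<open>G\<close>.\<close>
    using main[of l] by (simp add: num_matchings_0)
  ultimately show ?thesis
    using \<open>forest F\<close> \<phi>U main unfolding G_def by blast
qed

end
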